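(* For every integer $n\geq 5$, there exists a (connected, simple) $4$-regular graph of order $n$ which is not doubly Eulerian.
   Context: All graphs are finite, simple and connected. An Eulerian circuit is a closed trail traversing every edge exactly once. For an Eulerian graph with $m$ edges and vertex $u$, two Eulerian circuits $u,v_1,\ldots,v_{m-1},u$ and $u,w_1,\ldots,w_{m-1},u$ are avoiding if for every $1\le i\le m-1$, $v_i\neq w_i$ and $v_i$ is not adjacent to $w_i$. A graph is doubly Eulerian if it is Eulerian and for every vertex $u$ there is a pair of avoiding Eulerian circuits starting and ending at $u$. *)

theory Defs
  imports Graph_Theory.Graph_Theory
begin

text \<open>
  Finite simple undirected graphs are the locale \<^locale>\<open>pair_graph\<close>: a finite vertex set with a
  finite, symmetric and loopless set of arcs, parallel arcs being excluded by the representation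
  of arcs as pairs. Each undirected edge corresponds to two opposite arcs, so the Eulerian trails
  of the library, which use every arc once, are not Eulerian trails of the undirected graph;
  edges are identified below with unordered pairs.
\<close>

definition edge_of :: "'a \<times> 'a \<Rightarrow> 'a set" where
  "edge_of a = {fst a, snd a}"

definition uedges :: "'a pair_pre_digraph \<Rightarrow> 'a set set" where
  "uedges G = edge_of ` parcs G"

text \<open>
  A circuit is given by its vertex sequence with the starting vertex repeated at the end, so an
  Eulerian circuit of a graph with \<open>m\<close> edges is a list of length \<open>m + 1\<close>.
\<close>

definition eulerian_circuit :: "'a pair_pre_digraph \<Rightarrow> 'a \<Rightarrow> 'a list \<Rightarrow> bool" where
  "eulerian_circuit G u p \<longleftrightarrow>
     vwalk p (with_proj G) \<and> hd p = u \<and> last p = u \<and>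
     distinct (map edge_of (vwalk_arcs p)) \<and>
     edge_of ` set (vwalk_arcs p) = uedges G"

definition eulerian :: "'a pair_pre_digraph \<Rightarrow> bool" where
  "eulerian G \<longleftrightarrow> (\<exists>u\<in>pverts G. \<exists>p. eulerian_circuit G u p)"

definition avoiding :: "'a pair_pre_digraph \<Rightarrow> 'a list \<Rightarrow> 'a list \<Rightarrow> bool" where
  "avoiding G p q \<longleftrightarrow>
     (\<forall>i. 1 \<le> i \<and> i \<le> card (uedges G) - 1 \<longrightarrow> p ! i \<noteq> q ! i \<and> (p ! i, q ! i) \<notin> parcs G)"

definition doubly_eulerian :: "'a pair_pre_digraph \<Rightarrow> bool" where
  "doubly_eulerian G \<longleftrightarrow>
     eulerian G \<and>
     (\<forall>u\<in>pverts G. \<exists>p q. eulerian_circuit G u p \<and> eulerian_circuit G u q \<and> avoiding G p q)"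

text \<open>By symmetry of the arc set, the degree of a vertex is its out-degree.\<close>

definition regular :: "nat \<Rightarrow> 'a pair_pre_digraph \<Rightarrow> bool" where
  "regular k G \<longleftrightarrow> (\<forall>v\<in>pverts G. out_degree (with_proj G) v = k)"

end

(*
  In a 4-regular graph of order n an Eulerian circuit has length 2n and meets every vertex exactly
  twice. Hence it spends exactly 2 |S| time steps in any vertex set S, one fewer when the common
  start at the circuit's initial vertex u is not counted and u lies in S. Comparing these
  occupation times for two circuits from u gives contradictions.

  n <= 8: there are sets A and B with |A| = |B| and u in B such that every vertex that is neither
  equal nor adjacent to a member of A lies in B. Whenever one circuit is in A the other one is in
  B, but the interior of a circuit spends more time in A than in B.
  n = 9: the same with |B| = |A| + 1, where two moments are lost because at the second and the
  penultimate step both circuits are at neighbours of u, which lie in B.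
  n = 10: two copies of K5 minus an edge, joined by two edges. Each circuit stays in the copy not
  containing u for 10 consecutive steps, so both are there at times 9 and 10, but that copy has
  only one nonadjacent pair.
  n >= 11: u is a cut vertex with two lobes of orders k and l, where l = k or l = k + 1. A circuit
  returns to u at time 2k + 1 or 2l + 1, depending on the lobe it visits first, and two avoiding
  circuits start in different lobes. This is impossible if k = l. If l = k + 1, then at time 2l one
  circuit enters the larger lobe while the other is about to leave it, so both are at the two
  neighbours of u in this lobe, which are chosen adjacent.
*)
theory Submission
  imports Defs
begin

section \<open>Eulerian circuits in 4-regular graphs\<close>

lemma length_vwalk_arcs: "length (vwalk_arcs p) = length p - 1"
  by (induction p rule: vwalk_arcs.induct) auto

lemma nth_vwalk_arcs: "Suc i < length p \<Longrightarrow> vwalk_arcs p ! i = (p ! i, p ! Suc i)"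
proof (induction p arbitrary: i rule: vwalk_arcs.induct)
  case (3 x y xs)
  then show ?case by (cases i) auto
qed auto

lemma edge_of_eq_iff: "edge_of (a, b) = edge_of (c, d) \<longleftrightarrow> a = c \<and> b = d \<or> a = d \<and> b = c"
  by (auto simp: edge_of_def doubleton_eq_iff)

text \<open>With \<open>P\<close> the membership of \<open>f i\<close> in a vertex set or its
  complement, this finds a step at which a circuit crosses the boundary of the set.\<close>

lemma exists_descent:
  fixes i j :: nat
  assumes "i < j" "P i" "\<not> P j"
  shows "\<exists>l. i \<le> l \<and> l < j \<and> P l \<and> \<not> P (Suc l)"
  using assms
proof (induction j)
  case (Suc j)
  show ?case
  proof (cases "P j")
    case True
    then have "i \<le> j \<and> j < Suc j \<and> P j \<and> \<not> P (Suc j)" using Suc.prems by simp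
    then show ?thesis by (rule exI)
  next
    case False
    then have "i < j" using Suc.prems by (metis less_antisym)
    then obtain l where "i \<le> l" "l < j" "P l" "\<not> P (Suc l)"
      using Suc.IH Suc.prems(2) False by auto
    then have "i \<le> l \<and> l < Suc j \<and> P l \<and> \<not> P (Suc l)" by simp
    then show ?thesis by (rule exI)
  qed
qed simp

locale quartic_graph = pair_graph +
  assumes quartic: "regular 4 G"
begin

section \<open>Circuits as functions of time\<close>

abbreviation size_G :: nat where "size_G \<equiv> card (uedges G)"

definition circuit :: "'a \<Rightarrow> (nat \<Rightarrow> 'a) \<Rightarrow> bool" where
  "circuit u f \<longleftrightarrow>
     f 0 = u \<and> f size_G = u \<and>
     (\<forall>i<size_G. (f i, f (Suc i)) \<in> parcs G) \<and>
     inj_on (\<lambda>i. edge_of (f i, f (Suc i))) {..<size_G} \<and>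
     (\<lambda>i. edge_of (f i, f (Suc i))) ` {..<size_G} = uedges G"

definition apart :: "(nat \<Rightarrow> 'a) \<Rightarrow> (nat \<Rightarrow> 'a) \<Rightarrow> bool" where
  "apart f g \<longleftrightarrow> (\<forall>i. 0 < i \<and> i < size_G \<longrightarrow> f i \<noteq> g i \<and> (f i, g i) \<notin> parcs G)"

lemma circuit_nth:
  assumes "eulerian_circuit G u p"
  shows "circuit u (nth p)"
proof -
  let ?A = "vwalk_arcs p"
  from assms have p: "p \<noteq> []" "set ?A \<subseteq> parcs G" "hd p = u" "last p = u"
    and dist: "distinct (map edge_of ?A)" and im: "edge_of ` set ?A = uedges G"
    by (auto simp: eulerian_circuit_def vwalk_def)
  have len: "length ?A = size_G"
    using dist im by (metis distinct_card length_map list.set_map)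
  then have lenp: "length p = Suc size_G"
    using p(1) length_vwalk_arcs[of p] by (cases p) auto
  have nth: "?A ! i = (p ! i, p ! Suc i)" if "i < size_G" for i
    using that lenp by (intro nth_vwalk_arcs) simp
  have arcs: "(p ! i, p ! Suc i) \<in> parcs G" if "i < size_G" for i
    using that nth[OF that] len p(2) by (metis nth_mem subsetD)
  have inj: "inj_on (\<lambda>i. edge_of (p ! i, p ! Suc i)) {..<size_G}"
    using dist len nth by (auto simp: distinct_conv_nth inj_on_def)
  have "edge_of ` set ?A = (\<lambda>i. edge_of (?A ! i)) ` {..<size_G}"
    using len by (auto simp: set_conv_nth)
  also have "\<dots> = (\<lambda>i. edge_of (p ! i, p ! Suc i)) ` {..<size_G}"
    using nth by (intro image_cong) auto
  finally have "(\<lambda>i. edge_of (p ! i, p ! Suc i)) ` {..<size_G} = uedges G"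
    using im by simp
  moreover have "p ! 0 = u" "p ! size_G = u"
    using p lenp by (auto simp: hd_conv_nth last_conv_nth)
  ultimately show ?thesis
    using arcs inj by (auto simp: circuit_def)
qed

lemma symD: "(a, b) \<in> parcs G \<Longrightarrow> (b, a) \<in> parcs G"
  using pair_sym_arcs by (auto simp: symmetric_def sym_def)

lemma no_loop: "(a, a) \<notin> parcs G"
  using pair_no_loops by fastforce

text \<open>Each edge at \<open>v\<close> has exactly one orientation starting at \<open>v\<close>,
  so \<open>edge_of\<close> maps the outgoing arcs bijectively to the edges at
  \<open>v\<close>.\<close>

lemma card_incident_edges:
  assumes "v \<in> pverts G"
  shows "card {e \<in> uedges G. v \<in> e} = 4"
proof -
  have "card {e \<in> uedges G. v \<in> e} = card {a \<in> parcs G. fst a = v}"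
  proof (rule bij_betw_same_card[symmetric])
    show "bij_betw edge_of {a \<in> parcs G. fst a = v} {e \<in> uedges G. v \<in> e}"
      unfolding bij_betw_def
    proof
      show "inj_on edge_of {a \<in> parcs G. fst a = v}"
        by (auto simp: inj_on_def edge_of_eq_iff)
      show "edge_of ` {a \<in> parcs G. fst a = v} = {e \<in> uedges G. v \<in> e}"
      proof (intro subset_antisym subsetI)
        fix e assume "e \<in> {e \<in> uedges G. v \<in> e}"
        then obtain a b where ab: "(a, b) \<in> parcs G" "e = {a, b}" "v = a \<or> v = b"
          by (auto simp: uedges_def edge_of_def)
        then show "e \<in> edge_of ` {a \<in> parcs G. fst a = v}"
          using symD[of a b] by (force simp: edge_of_def image_iff)
      qed (auto simp: uedges_def edge_of_def)
    qed
  qed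
  also have "\<dots> = 4"
    using quartic assms by (simp add: regular_def out_degree_def out_arcs_def)
  finally show ?thesis .
qed

section \<open>Occupation times of vertex sets\<close>

context
  fixes u f
  assumes circ: "circuit u f"
begin

lemma circuit_ends: "f 0 = u" "f size_G = u"
  and circuit_arc: "i < size_G \<Longrightarrow> (f i, f (Suc i)) \<in> parcs G"
  and circuit_inj: "\<lbrakk>i < size_G; j < size_G; edge_of (f i, f (Suc i)) = edge_of (f j, f (Suc j))\<rbrakk> \<Longrightarrow> i = j"
  and circuit_image: "(\<lambda>i. edge_of (f i, f (Suc i))) ` {..<size_G} = uedges G"
  using circ by (auto simp: circuit_def inj_on_def)

lemma circuit_in_verts: "i < size_G \<Longrightarrow> f i \<in> pverts G"
  using circuit_arc in_arcsD1 by blast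

text \<open>The four edges at \<open>v\<close> are traversed once each, and without loops no step
  both leaves and enters \<open>v\<close>. A closed walk leaves \<open>v\<close> as often as it
  enters it, hence twice.\<close>

lemma visits_vertex:
  assumes "v \<in> pverts G"
  shows "card {i. i < size_G \<and> f i = v} = 2"
proof -
  let ?A = "{i. i < size_G \<and> f i = v}" and ?B = "{i. i < size_G \<and> f (Suc i) = v}"
  let ?e = "\<lambda>i. edge_of (f i, f (Suc i))"
  have fin: "finite ?A" "finite ?B" by auto
  have disj: "?A \<inter> ?B = {}"
    using circuit_arc no_loop by auto (metis)
  have in_e: "v \<in> ?e i \<longleftrightarrow> f i = v \<or> f (Suc i) = v" for i
    by (auto simp: edge_of_def)
  have "?e ` (?A \<union> ?B) = {e \<in> ?e ` {..<size_G}. v \<in> e}"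
    using in_e by blast
  then have "?e ` (?A \<union> ?B) = {e \<in> uedges G. v \<in> e}"
    by (simp only: circuit_image)
  moreover have "inj_on ?e (?A \<union> ?B)"
    by (rule inj_onI, rule circuit_inj) auto
  ultimately have "card (?A \<union> ?B) = 4"
    using card_incident_edges[OF assms] card_image[of ?e "?A \<union> ?B"] by simp
  then have sum: "card ?A + card ?B = 4"
    using card_Un_disjoint[OF fin disj] by simp
  \<comment> \<open>Departures from \<open>v\<close> sum \<open>g i\<close>, arrivals sum
    \<open>g (Suc i)\<close>; the sums differ only by end terms, which agree on a closed
    walk.\<close>
  define g :: "nat \<Rightarrow> nat" where "g i = of_bool (f i = v)" for i
  have "card ?A = (\<Sum>i<size_G. g i)" "card ?B = (\<Sum>i<size_G. g (Suc i))"
    unfolding g_def by (simp_all add: sum_of_bool_eq lessThan_def Collect_conj_eq)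
  moreover have "(\<Sum>i<size_G. g (Suc i)) + g 0 = (\<Sum>i<size_G. g i) + g size_G"
    using sum.lessThan_Suc_shift[of g size_G] sum.lessThan_Suc[of g size_G] by linarith
  moreover have "g 0 = g size_G"
    using circuit_ends by (simp add: g_def)
  ultimately show ?thesis using sum by linarith
qed

lemma visits:
  assumes "S \<subseteq> pverts G"
  shows "card {i. i < size_G \<and> f i \<in> S} = 2 * card S"
proof -
  have fin: "finite S" using assms pair_finite_verts finite_subset by blast
  have "{i. i < size_G \<and> f i \<in> S} = (\<Union>v\<in>S. {i. i < size_G \<and> f i = v})" by auto
  also have "card \<dots> = (\<Sum>v\<in>S. card {i. i < size_G \<and> f i = v})"
    using fin by (intro card_UN_disjoint) auto
  also have "\<dots> = (\<Sum>v\<in>S. 2)"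
    using assms visits_vertex by (intro sum.cong) auto
  finally show ?thesis by simp
qed

lemma size_G_eq: "size_G = 2 * card (pverts G)"
proof -
  have "{i. i < size_G \<and> f i \<in> pverts G} = {..<size_G}"
    using circuit_in_verts by auto
  then show ?thesis using visits[of "pverts G"] by simp
qed

lemma interior_visits:
  assumes "S \<subseteq> pverts G"
  shows "card {i. 0 < i \<and> i < size_G \<and> f i \<in> S} = 2 * card S - of_bool (u \<in> S)"
proof (cases "size_G = 0")
  case True
  then have "pverts G = {}" using size_G_eq pair_finite_verts by auto
  then show ?thesis using assms by auto
next
  case False
  let ?A = "{i. i < size_G \<and> f i \<in> S}"
  \<comment> \<open>Only the start at time 0 is lost: the final return at \<open>size_G\<close> is
    outside the range in both counts.\<close>
  have "{i. 0 < i \<and> i < size_G \<and> f i \<in> S} = ?A - {0}" by auto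
  moreover have "0 \<in> ?A \<longleftrightarrow> u \<in> S"
    using False circuit_ends(1) by simp
  ultimately show ?thesis
    using visits[OF assms] card_Diff_singleton_if[of ?A 0] by (cases "u \<in> S") simp_all
qed

end

lemma apart_commute: "apart f g \<Longrightarrow> apart g f"
  using symD by (fastforce simp: apart_def)

section \<open>Criteria from counting time steps\<close>

lemma not_doubly_eulerianI:
  assumes "u \<in> pverts G"
    and "\<And>f g. \<lbrakk>circuit u f; circuit u g; apart f g\<rbrakk> \<Longrightarrow> False"
  shows "\<not> doubly_eulerian G"
proof
  assume "doubly_eulerian G"
  then obtain p q where "eulerian_circuit G u p" "eulerian_circuit G u q" "avoiding G p q"
    using assms(1) by (auto simp: doubly_eulerian_def)
  moreover have "apart (nth p) (nth q)"
    using \<open>avoiding G p q\<close> by (auto simp: avoiding_def apart_def)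
  ultimately show False
    using assms(2) circuit_nth by blast
qed

text \<open>At interior times \<open>g\<close> is in \<open>B\<close> whenever \<open>f\<close> is
  in \<open>A\<close>. As \<open>B\<close> contains the start and \<open>A\<close> does not, this
  would give \<open>2 * card A \<le> 2 * card B - 1\<close>.\<close>

lemma not_doubly_eulerian_if_balanced:
  assumes "A \<subseteq> pverts G" "B \<subseteq> pverts G" "u \<in> B" "u \<notin> A"
    and partner: "\<And>x y. \<lbrakk>x \<in> A; y \<in> pverts G; x \<noteq> y; (x, y) \<notin> parcs G\<rbrakk> \<Longrightarrow> y \<in> B"
    and "card B \<le> card A"
  shows "\<not> doubly_eulerian G"
proof (rule not_doubly_eulerianI)
  show "u \<in> pverts G" using assms by blast
  fix f g assume f: "circuit u f" and g: "circuit u g" and "apart f g"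
  then have "{i. 0 < i \<and> i < size_G \<and> f i \<in> A} \<subseteq> {i. 0 < i \<and> i < size_G \<and> g i \<in> B}"
    using partner circuit_in_verts[OF g] by (auto simp: apart_def)
  then have "card {i. 0 < i \<and> i < size_G \<and> f i \<in> A} \<le> card {i. 0 < i \<and> i < size_G \<and> g i \<in> B}"
    by (intro card_mono) auto
  moreover have "card B > 0"
    using assms pair_finite_verts finite_subset card_gt_0_iff by blast
  ultimately show False
    using interior_visits[OF f] interior_visits[OF g] assms by auto
qed

text \<open>At times 1 and \<open>size_G - 1\<close> both circuits are at neighbours of
  \<open>u\<close>, hence in \<open>B\<close> and outside \<open>A\<close>. Losing these two times
  leaves \<open>2 * card A \<le> 2 * card B - 3\<close>.\<close>

lemma not_doubly_eulerian_if_nearly_balanced: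
  assumes "A \<subseteq> pverts G" "B \<subseteq> pverts G" "u \<in> B" "A \<inter> B = {}"
    and partner: "\<And>x y. \<lbrakk>x \<in> A; y \<in> pverts G; x \<noteq> y; (x, y) \<notin> parcs G\<rbrakk> \<Longrightarrow> y \<in> B"
    and nbrs: "\<And>x. (u, x) \<in> parcs G \<Longrightarrow> x \<in> B"
    and "card B \<le> Suc (card A)" "card A > 0"
  shows "\<not> doubly_eulerian G"
proof (rule not_doubly_eulerianI)
  show "u \<in> pverts G" using assms by blast
  fix f g assume f: "circuit u f" and g: "circuit u g" and ap: "apart f g"
  let ?A = "{i. 0 < i \<and> i < size_G \<and> f i \<in> A}" and ?B = "{i. 0 < i \<and> i < size_G \<and> g i \<in> B}"
  \<comment> \<open>Two disjoint nonempty sets force \<open>size_G \<ge> 4\<close>, so that 1 and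
    \<open>size_G - 1\<close> are distinct interior times.\<close>
  have "card (A \<union> B) \<le> card (pverts G)"
    using assms pair_finite_verts by (intro card_mono) auto
  moreover have cB: "card B > 0"
    using assms pair_finite_verts finite_subset card_gt_0_iff by blast
  moreover have "card (A \<union> B) = card A + card B"
    using assms pair_finite_verts finite_subset by (metis card_Un_disjoint)
  ultimately have m: "4 \<le> size_G"
    using size_G_eq[OF f] assms by linarith
  have ends: "h 1 \<in> B" "h (size_G - 1) \<in> B" if "circuit u h" for h
  proof -
    show "h 1 \<in> B"
      using nbrs circuit_arc[OF that, of 0] circuit_ends[OF that] m by simp
    have "(h (size_G - 1), u) \<in> parcs G"
      using circuit_arc[OF that, of "size_G - 1"] circuit_ends[OF that] m by simp
    then show "h (size_G - 1) \<in> B" using nbrs symD by blast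
  qed
  have "?A \<subseteq> ?B"
    using partner circuit_in_verts[OF g] ap by (auto simp: apart_def)
  moreover have "1 \<in> ?B - ?A" "size_G - 1 \<in> ?B - ?A"
    using ends[OF f] ends[OF g] m assms(4) by auto
  ultimately have "?A \<subseteq> ?B - {1, size_G - 1}" by blast
  then have "card ?A \<le> card (?B - {1, size_G - 1})"
    by (intro card_mono) auto
  also have "\<dots> = card ?B - card {1, size_G - 1}"
    using ends[OF g] m by (intro card_Diff_subset) auto
  also have "card {1, size_G - 1} = 2"
    using m by simp
  finally have "card ?A \<le> card ?B - 2" .
  moreover have "card ?A = 2 * card A" "card ?B = 2 * card B - 1"
    using interior_visits[OF f assms(1)] interior_visits[OF g assms(2)] assms(3,4) by auto
  ultimately show False using assms(7,8) by linarith
qed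

text \<open>With \<open>k = card C\<close>, a circuit spends \<open>2 * k\<close> of its
  \<open>4 * k\<close> steps in \<open>C\<close>, in a single run since \<open>F\<close> allows only
  two crossings. The run avoids times 0, 1 and \<open>size_G - 1\<close>, so it covers
  \<open>2 * k - 1\<close> and \<open>2 * k\<close>. Then \<open>f\<close> is in \<open>D\<close> at
  two consecutive times, although \<open>D\<close> is independent.\<close>

lemma not_doubly_eulerian_if_two_edge_cut:
  assumes "u \<in> pverts G" "u \<notin> C" "C \<subseteq> pverts G"
    and half: "card (pverts G) = 2 * card C"
    and nbrs: "\<And>x. (u, x) \<in> parcs G \<Longrightarrow> x \<notin> C"
    and cut: "\<And>x y. \<lbrakk>x \<in> C; y \<notin> C; (x, y) \<in> parcs G\<rbrakk> \<Longrightarrow> edge_of (x, y) \<in> F"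
    and F: "finite F" "card F \<le> 2"
    and partner: "\<And>x y. \<lbrakk>x \<in> C; y \<in> C; x \<noteq> y; (x, y) \<notin> parcs G\<rbrakk> \<Longrightarrow> x \<in> D"
    and indep: "\<And>x y. \<lbrakk>x \<in> D; y \<in> D\<rbrakk> \<Longrightarrow> (x, y) \<notin> parcs G"
  shows "\<not> doubly_eulerian G"
proof (rule not_doubly_eulerianI)
  show "u \<in> pverts G" by fact
  define k where "k = card C"
  have "card (pverts G) > 0"
    using assms(1) pair_finite_verts card_gt_0_iff by blast
  then have k: "0 < k" using half k_def by simp
  have inside: "f i \<in> C" if f: "circuit u f" and i: "i \<in> {2 * k - 1, 2 * k}" for f i
  proof (rule ccontr)
    assume "f i \<notin> C"
    have m: "size_G = 4 * k" using size_G_eq[OF f] half k_def by simp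
    let ?T = "{i. i < size_G \<and> f i \<in> C}"
    have cT: "card ?T = 2 * k" using visits[OF f assms(3)] k_def by simp
    have "f 1 \<notin> C"
      using nbrs circuit_arc[OF f, of 0] circuit_ends[OF f] m k by simp
    moreover have "(f (size_G - 1), u) \<in> parcs G"
      using circuit_arc[OF f, of "size_G - 1"] circuit_ends[OF f] m k by simp
    then have "f (size_G - 1) \<notin> C" using nbrs symD by blast
    ultimately have T: "1 < t \<and> t < size_G - 1" if "t \<in> ?T" for t
      using that circuit_ends[OF f] assms(2) by (cases t; cases "t = 1"; cases "t = size_G - 1") auto
    have "\<exists>s\<in>?T. s < i"
    proof (rule ccontr)
      assume "\<not> ?thesis"
      moreover have "i \<notin> ?T" using \<open>f i \<notin> C\<close> by simp
      ultimately have "i < t" if "t \<in> ?T" for t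
        using that by (cases i t rule: linorder_cases) blast+
      \<comment> \<open>This interval has at most \<open>2 * k - 1\<close> elements, too few for the
        \<open>2 * k\<close> visits to \<open>C\<close>.\<close>
      then have "?T \<subseteq> {i<..<size_G - 1}" using T by (simp add: subset_iff)
      from card_mono[OF _ this] show False using cT m i k by auto
    qed
    then obtain s where s: "s < i" "f s \<in> C" "s \<in> ?T" by blast
    have "\<exists>t\<in>?T. i < t"
    proof (rule ccontr)
      assume "\<not> ?thesis"
      moreover have "i \<notin> ?T" using \<open>f i \<notin> C\<close> by simp
      ultimately have "t < i" if "t \<in> ?T" for t
        using that by (cases i t rule: linorder_cases) blast+
      then have "?T \<subseteq> {1<..<i}" using T by (simp add: subset_iff)
      from card_mono[OF _ this] show False using cT m i k by auto
    qed
    then obtain t where t: "i < t" "f t \<in> C" "t < size_G" by blast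
    have "0 < s" using T[OF s(3)] by simp
    \<comment> \<open>Step \<open>a\<close> enters \<open>C\<close>, step \<open>b\<close> leaves it
      by time \<open>i\<close>, and step \<open>c\<close> enters it again: three distinct edges of
      \<open>F\<close>.\<close>
    then obtain a where a: "a < s" "f a \<notin> C" "f (Suc a) \<in> C"
      using exists_descent[of 0 s "\<lambda>i. f i \<notin> C"] circuit_ends[OF f] assms(2) s by auto
    obtain b where b: "s \<le> b" "b < i" "f b \<in> C" "f (Suc b) \<notin> C"
      using exists_descent[of s i "\<lambda>i. f i \<in> C"] s \<open>f i \<notin> C\<close> by auto
    obtain c where c: "i \<le> c" "c < t" "f c \<notin> C" "f (Suc c) \<in> C"
      using exists_descent[of i t "\<lambda>i. f i \<notin> C"] t \<open>f i \<notin> C\<close> by auto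
    let ?e = "\<lambda>i. edge_of (f i, f (Suc i))"
    have lt: "a < size_G" "b < size_G" "c < size_G" using a b c t by auto
    have swap: "edge_of (x, y) = edge_of (y, x)" for x y :: 'a
      by (auto simp: edge_of_def)
    have sub: "{?e a, ?e b, ?e c} \<subseteq> F"
      using cut[OF a(3) a(2) symD[OF circuit_arc[OF f lt(1)]]]
        cut[OF b(3,4) circuit_arc[OF f lt(2)]]
        cut[OF c(4) c(3) symD[OF circuit_arc[OF f lt(3)]]] by (simp add: swap)
    have "a \<noteq> b" "a \<noteq> c" "b \<noteq> c" using a b c by auto
    then have "?e a \<noteq> ?e b" "?e a \<noteq> ?e c" "?e b \<noteq> ?e c"
      using circuit_inj[OF f] lt by blast+
    then have "card {?e a, ?e b, ?e c} = 3" by (simp only: card_3_iff) blast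
    then show False using card_mono[OF F(1) sub] F(2) by linarith
  qed
  fix f g assume f: "circuit u f" and g: "circuit u g" and ap: "apart f g"
  have m: "size_G = 4 * k" using size_G_eq[OF f] half k_def by simp
  have D: "f i \<in> D" if i: "i \<in> {2 * k - 1, 2 * k}" for i
    using partner[OF inside[OF f i] inside[OF g i]] ap i m k by (auto simp: apart_def)
  have "(f (2 * k - 1), f (Suc (2 * k - 1))) \<in> parcs G"
    using circuit_arc[OF f, of "2 * k - 1"] m k by simp
  then show False using indep D k by simp
qed


section \<open>The cut vertex criterion\<close>

lemma stays_inside:
  assumes "circuit u f" "j \<le> size_G" "i < i'" "i' < j"
    and "\<And>l. \<lbrakk>i \<le> l; l < j\<rbrakk> \<Longrightarrow> f l \<noteq> u"
    and "f i \<in> L"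
    and "\<And>x y. \<lbrakk>x \<in> L; (x, y) \<in> parcs G\<rbrakk> \<Longrightarrow> y \<in> L \<or> y = u"
  shows "f i' \<in> L"
proof (rule ccontr)
  assume "f i' \<notin> L"
  \<comment> \<open>The only exit from \<open>L\<close> is through \<open>u\<close>, which is not
    met before time \<open>j\<close>.\<close>
  then obtain l where l: "i \<le> l" "l < i'" "f l \<in> L" "f (Suc l) \<notin> L"
    using exists_descent[of i i' "\<lambda>i. f i \<in> L"] assms by auto
  have "(f l, f (Suc l)) \<in> parcs G"
    using circuit_arc[OF assms(1), of l] l assms by simp
  then have "f (Suc l) = u"
    using assms(7) l by blast
  then show False using assms(5)[of "Suc l"] l assms(4) by auto
qed

text \<open>The circuit has one interior return to \<open>u\<close>, at a time \<open>k\<close>, and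
  each of the two excursions stays in one lobe. The second is in \<open>L'\<close>, which must be
  visited; so the first makes all \<open>2 * card L\<close> visits to \<open>L\<close>, and
  \<open>k = j\<close>.\<close>

lemma lobe_tour:
  assumes f: "circuit u f" and "u \<in> pverts G"
    and L: "pverts G = insert u (L \<union> L')" "u \<notin> L" "u \<notin> L'" "L \<inter> L' = {}" "L' \<noteq> {}"
    and cut: "\<And>x y. \<lbrakk>x \<in> L; y \<in> L'\<rbrakk> \<Longrightarrow> (x, y) \<notin> parcs G"
    and start: "f 1 \<in> L"
  defines "j \<equiv> 2 * card L + 1"
  shows "j < size_G \<and> f j = u \<and> (\<forall>i. 0 < i \<and> i < j \<longrightarrow> f i \<in> L) \<and> (\<forall>i. j < i \<and> i < size_G \<longrightarrow> f i \<in> L')"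
proof -
  have cut': "y \<in> L \<or> y = u" if "x \<in> L" "(x, y) \<in> parcs G" for x y
    using that cut L(1) in_arcsD2 by blast
  have cut'': "y \<in> L' \<or> y = u" if "x \<in> L'" "(x, y) \<in> parcs G" for x y
    using that cut L(1) in_arcsD2 symD by blast
  have "card {i. 0 < i \<and> i < size_G \<and> f i \<in> {u}} = 1"
    using interior_visits[OF f, of "{u}"] assms(2) by simp
  then obtain k where k: "{i. 0 < i \<and> i < size_G \<and> f i \<in> {u}} = {k}"
    using card_1_singletonE by blast
  then have uk: "0 < i \<and> i < size_G \<and> f i = u \<longleftrightarrow> i = k" for i by auto
  have k0: "0 < k" "k < size_G" "f k = u" using uk[of k] by auto
  have not_u: "f i \<noteq> u" if "0 < i" "i < size_G" "i \<noteq> k" for i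
    using that uk by blast
  have k1: "1 < k" using k0 start L(2) by (cases "k = 1") auto
  have arc: "(u, f (Suc k)) \<in> parcs G" using circuit_arc[OF f k0(2)] k0 by simp
  \<comment> \<open>Otherwise the step after the return would be a loop at \<open>u\<close>.\<close>
  have k2: "Suc k < size_G"
    using arc no_loop circuit_ends[OF f] k0 by (metis Suc_lessI)
  have before: "f i \<in> L" if "0 < i" "i < k" for i
  proof (cases "i = 1")
    case False
    then show ?thesis
      using that k0 not_u start cut' by (intro stays_inside[OF f, of k 1 i L]) auto
  qed (use start in simp)
  have fin: "finite L'" using L(1) pair_finite_verts by simp
  have visits': "{i. 0 < i \<and> i < size_G \<and> f i \<in> L'} \<noteq> {}"
  proof -
    have "L' \<subseteq> pverts G" "card L' > 0" using L fin by (auto simp: card_gt_0_iff)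
    then have "card {i. 0 < i \<and> i < size_G \<and> f i \<in> L'} > 0"
      using interior_visits[OF f, of L'] L(3) by simp
    then show ?thesis by (metis card.empty less_irrefl)
  qed
  have "f (Suc k) \<in> L'"
  proof (rule ccontr)
    assume "f (Suc k) \<notin> L'"
    moreover have "f (Suc k) \<in> pverts G" "f (Suc k) \<noteq> u"
      using arc in_arcsD2 no_loop by metis+
    ultimately have S: "f (Suc k) \<in> L" using L(1) by blast
    have "f i \<in> L" if "k < i" "i < size_G" for i
    proof (cases "i = Suc k")
      case False
      then show ?thesis
        using that k0 not_u S cut' by (intro stays_inside[OF f, of size_G "Suc k" i L]) auto
    qed (use S in simp)
    then have "f i \<notin> L'" if "0 < i" "i < size_G" for i
      using that before[of i] k0 L(3,4) by (cases i k rule: linorder_cases) auto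
    then show False using visits' by blast
  qed
  have after: "f i \<in> L'" if "k < i" "i < size_G" for i
  proof (cases "i = Suc k")
    case False
    then show ?thesis
      using that k0 not_u \<open>f (Suc k) \<in> L'\<close> cut'' by (intro stays_inside[OF f, of size_G "Suc k" i L']) auto
  qed (use \<open>f (Suc k) \<in> L'\<close> in simp)
  have "{i. 0 < i \<and> i < size_G \<and> f i \<in> L} = {0<..<k}"
  proof (intro set_eqI iffI)
    fix i assume i: "i \<in> {i. 0 < i \<and> i < size_G \<and> f i \<in> L}"
    then show "i \<in> {0<..<k}"
      using after[of i] k0 L(2,4) by (cases i k rule: linorder_cases) auto
  qed (use before k0 in auto)
  moreover have "L \<subseteq> pverts G" using L(1) by blast
  ultimately have "2 * card L = k - 1"
    using interior_visits[OF f, of L] L(2) by simp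
  then have "k = j" using k0 by (simp add: j_def)
  then show ?thesis using before after k0 by blast
qed

text \<open>Circuits starting in the same lobe return to \<open>u\<close> simultaneously, as do all
  circuits if the lobes have equal size. The remaining case is that of different lobes with sizes
  differing by one.\<close>

lemma not_doubly_eulerian_if_cut_vertex:
  assumes u: "u \<in> pverts G"
    and L: "pverts G = insert u (L1 \<union> L2)" "u \<notin> L1" "u \<notin> L2" "L1 \<inter> L2 = {}" "L1 \<noteq> {}" "L2 \<noteq> {}"
    and cut: "\<And>x y. \<lbrakk>x \<in> L1; y \<in> L2\<rbrakk> \<Longrightarrow> (x, y) \<notin> parcs G"
    and sizes: "card L2 = card L1 \<or> card L2 = Suc (card L1) \<and>
      (\<forall>x\<in>L2. \<forall>y\<in>L2. (u, x) \<in> parcs G \<and> (u, y) \<in> parcs G \<longrightarrow> x = y \<or> (x, y) \<in> parcs G)"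
  shows "\<not> doubly_eulerian G"
proof (rule not_doubly_eulerianI[OF u])
  let ?j1 = "2 * card L1 + 1" and ?j2 = "2 * card L2 + 1"
  have fin: "finite L1" "finite L2" using L(1) pair_finite_verts by auto
  \<comment> \<open>Besides the return time, a position in \<open>L2\<close> next to
    \<open>u\<close> is recorded: just after the return if \<open>L1\<close> comes first, just
    before it if \<open>L2\<close> does.\<close>
  have tour: "?j1 < size_G \<and> f ?j1 = u \<and> f (Suc ?j1) \<in> L2 \<or> ?j2 < size_G \<and> f ?j2 = u \<and> f (2 * card L2) \<in> L2"
    if f: "circuit u f" for f
  proof -
    have m: "size_G = 2 * Suc (card L1 + card L2)"
      using size_G_eq[OF f] L fin by (simp add: card_Un_disjoint)
    have pos: "0 < card L1" "0 < card L2" using L fin by (auto simp: card_gt_0_iff)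
    have "(u, f 1) \<in> parcs G"
      using circuit_arc[OF f, of 0] circuit_ends[OF f] m by simp
    then have "f 1 \<in> pverts G" "f 1 \<noteq> u" using in_arcsD2 no_loop by metis+
    then have "f 1 \<in> L1 \<or> f 1 \<in> L2" using L(1) by blast
    then show ?thesis
    proof
      assume "f 1 \<in> L1"
      from lobe_tour[OF f u L(1-4,6) cut this] show ?thesis using m pos by auto
    next
      assume f1: "f 1 \<in> L2"
      have L': "pverts G = insert u (L2 \<union> L1)" "L2 \<inter> L1 = {}" using L by auto
      have "\<And>x y. \<lbrakk>x \<in> L2; y \<in> L1\<rbrakk> \<Longrightarrow> (x, y) \<notin> parcs G" using cut symD by blast
      from lobe_tour[OF f u L'(1) L(3,2) L'(2) L(5) this f1] show ?thesis using m pos by auto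
    qed
  qed
  have mixed: False
    if f: "circuit u f" and g: "circuit u g" and ap: "apart f g"
      and fj: "?j1 < size_G" "f ?j1 = u" "f (Suc ?j1) \<in> L2"
      and gj: "?j2 < size_G" "g ?j2 = u" "g (2 * card L2) \<in> L2" for f g
  proof -
    from sizes show False
    proof
      assume "card L2 = card L1"
      then show False using ap fj gj by (auto simp: apart_def)
    next
      assume A: "card L2 = Suc (card L1) \<and>
        (\<forall>x\<in>L2. \<forall>y\<in>L2. (u, x) \<in> parcs G \<and> (u, y) \<in> parcs G \<longrightarrow> x = y \<or> (x, y) \<in> parcs G)"
      \<comment> \<open>\<open>f\<close> has just entered \<open>L2\<close> from \<open>u\<close>
        when \<open>g\<close> is one step before its return, so both are at neighbours of
        \<open>u\<close> in \<open>L2\<close>.\<close>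
      then have eq: "2 * card L2 = Suc ?j1" by simp
      have "(u, f (Suc ?j1)) \<in> parcs G" using circuit_arc[OF f fj(1)] fj by simp
      moreover have "(u, g (Suc ?j1)) \<in> parcs G"
        using circuit_arc[OF g, of "2 * card L2"] gj eq symD by simp
      ultimately have "f (Suc ?j1) = g (Suc ?j1) \<or> (f (Suc ?j1), g (Suc ?j1)) \<in> parcs G"
        using A fj gj eq by auto
      then show False using ap gj(1) eq by (auto simp: apart_def)
    qed
  qed
  fix f g assume f: "circuit u f" and g: "circuit u g" and ap: "apart f g"
  then show False
    using tour[OF f] tour[OF g] mixed[OF f g ap] mixed[OF g f apart_commute[OF ap]]
    by (auto simp: apart_def)
qed

end

section \<open>Graphs on initial segments of the natural numbers\<close>

text \<open>Symmetrised and made loopless here, so that concrete relations may list each adjacency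
  in one direction only.\<close>

definition joined :: "(nat \<Rightarrow> nat \<Rightarrow> bool) \<Rightarrow> nat \<Rightarrow> nat \<Rightarrow> bool" where
  "joined r i j \<longleftrightarrow> i \<noteq> j \<and> (r i j \<or> r j i)"

definition graph_on :: "nat \<Rightarrow> (nat \<Rightarrow> nat \<Rightarrow> bool) \<Rightarrow> nat pair_pre_digraph" where
  "graph_on n r = \<lparr>pverts = {..<n}, parcs = {(i, j). i < n \<and> j < n \<and> joined r i j}\<rparr>"

definition non_doubly_eulerian_order :: "nat \<Rightarrow> bool" where
  "non_doubly_eulerian_order n \<longleftrightarrow> (\<exists>G :: nat pair_pre_digraph.
     pair_graph G \<and> Digraph_Component.connected (with_proj G) \<and>
     card (pverts G) = n \<and> regular 4 G \<and> \<not> doubly_eulerian G)"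

lemma pverts_graph_on [simp]: "pverts (graph_on n r) = {..<n}"
  and arc_graph_on: "(i, j) \<in> parcs (graph_on n r) \<longleftrightarrow> i < n \<and> j < n \<and> joined r i j"
  by (auto simp: graph_on_def joined_def)

lemma pair_graph_graph_on: "pair_graph (graph_on n r)"
proof unfold_locales
  have "parcs (graph_on n r) \<subseteq> {..<n} \<times> {..<n}"
    by (auto simp: arc_graph_on)
  then show "finite (parcs (graph_on n r))"
    by (rule finite_subset) simp
  show "symmetric (with_proj (graph_on n r))"
    by (auto simp: symmetric_def sym_def arc_graph_on joined_def)
qed (auto simp: graph_on_def joined_def)

text \<open>Following smaller neighbours leads from every vertex down to 0.\<close>

lemma connected_graph_on:
  assumes "0 < n" and "\<And>v. \<lbrakk>0 < v; v < n\<rbrakk> \<Longrightarrow> \<exists>w<v. joined r w v"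
  shows "Digraph_Component.connected (with_proj (graph_on n r))"
proof -
  interpret pair_graph "graph_on n r" by (rule pair_graph_graph_on)
  let ?R = "rtrancl_on {..<n} ((parcs (graph_on n r))\<^sup>s)"
  have "(0, v) \<in> ?R" if "v < n" for v
    using that
  proof (induction v rule: less_induct)
    case (less v)
    show ?case
    proof (cases "v = 0")
      case False
      then obtain w where w: "w < v" "joined r w v" using assms(2) less.prems by auto
      then have "(0, w) \<in> ?R" using less by simp
      moreover have "(w, v) \<in> (parcs (graph_on n r))\<^sup>s"
        using w less.prems by (auto simp: symcl_def arc_graph_on)
      ultimately show ?thesis using less.prems by (auto intro: rtrancl_on_into_rtrancl_on)
    qed (use assms(1) in auto)
  qed
  moreover have "sym ?R"
    by (intro rtrancl_on_sym) (auto simp: sym_def symcl_def)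
  ultimately show ?thesis
    using assms(1) unfolding connected_conv by (auto dest: symD intro: rtrancl_on_trans)
qed

lemma quartic_graph_on:
  assumes "\<And>v. v < n \<Longrightarrow> card {j. j < n \<and> joined r v j} = 4"
  shows "quartic_graph (graph_on n r)"
proof -
  interpret pair_graph "graph_on n r" by (rule pair_graph_graph_on)
  have "card {e \<in> parcs (graph_on n r). fst e = v} = 4" if "v < n" for v
  proof -
    have "{e \<in> parcs (graph_on n r). fst e = v} = Pair v ` {j. j < n \<and> joined r v j}"
      using that by (auto simp: arc_graph_on)
    then show ?thesis using assms[OF that] by (simp add: card_image inj_on_def)
  qed
  then show ?thesis
    by unfold_locales (simp add: regular_def out_degree_def out_arcs_def)
qed

lemma non_doubly_eulerian_orderI:
  assumes "0 < n"
    and "\<And>v. \<lbrakk>0 < v; v < n\<rbrakk> \<Longrightarrow> \<exists>w<v. joined r w v"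
    and deg: "\<And>v. v < n \<Longrightarrow> card {j. j < n \<and> joined r v j} = 4"
    and "quartic_graph (graph_on n r) \<Longrightarrow> \<not> doubly_eulerian (graph_on n r)"
  shows "non_doubly_eulerian_order n"
proof -
  interpret quartic_graph "graph_on n r" using deg by (rule quartic_graph_on)
  show ?thesis
    unfolding non_doubly_eulerian_order_def
    using assms connected_graph_on pair_graph_graph_on quartic quartic_graph_axioms
    by (intro exI[of _ "graph_on n r"]) auto
qed

section \<open>Orders 5 to 10 by evaluation\<close>

definition quartic_check :: "nat \<Rightarrow> (nat \<Rightarrow> nat \<Rightarrow> bool) \<Rightarrow> bool" where
  "quartic_check n r \<longleftrightarrow>
     (\<forall>v\<in>set [1..<n]. \<exists>w\<in>set [0..<v]. joined r w v) \<and>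
     (\<forall>v\<in>set [0..<n]. length (filter (joined r v) [0..<n]) = 4)"

lemma non_doubly_eulerian_order_check:
  assumes "0 < n" "quartic_check n r"
    and "quartic_graph (graph_on n r) \<Longrightarrow> \<not> doubly_eulerian (graph_on n r)"
  shows "non_doubly_eulerian_order n"
proof (rule non_doubly_eulerian_orderI)
  show "\<exists>w<v. joined r w v" if "0 < v" "v < n" for v
    using assms(2) that by (fastforce simp: quartic_check_def)
  show "card {j. j < n \<and> joined r v j} = 4" if "v < n" for v
  proof -
    have "{j. j < n \<and> joined r v j} = set (filter (joined r v) [0..<n])" by auto
    then have "card {j. j < n \<and> joined r v j} = length (filter (joined r v) [0..<n])"
      by (metis distinct_card distinct_filter distinct_upt)
    then show ?thesis using assms(2) that by (simp add: quartic_check_def)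
  qed
qed (use assms in auto)

text \<open>Hypotheses shared by the two balance criteria, with quantifiers over lists so that
  \<open>code_simp\<close> can evaluate them.\<close>

definition partner_check :: "nat \<Rightarrow> (nat \<Rightarrow> nat \<Rightarrow> bool) \<Rightarrow> nat list \<Rightarrow> nat list \<Rightarrow> bool" where
  "partner_check n r A B \<longleftrightarrow>
     distinct A \<and> distinct B \<and> (\<forall>x\<in>set (A @ B). x < n) \<and>
     (\<forall>x\<in>set A. \<forall>y\<in>set [0..<n]. x = y \<or> joined r x y \<or> y \<in> set B)"

lemma partner_checkD:
  assumes "partner_check n r A B"
  shows "card (set A) = length A" "card (set B) = length B"
    and "set A \<subseteq> pverts (graph_on n r)" "set B \<subseteq> pverts (graph_on n r)"
    and "\<lbrakk>x \<in> set A; y \<in> pverts (graph_on n r); x \<noteq> y; (x, y) \<notin> parcs (graph_on n r)\<rbrakk> \<Longrightarrow> y \<in> set B"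
proof -
  show "card (set A) = length A" "card (set B) = length B"
    "set A \<subseteq> pverts (graph_on n r)" "set B \<subseteq> pverts (graph_on n r)"
    using assms by (auto simp: partner_check_def distinct_card)
  show "y \<in> set B" if "x \<in> set A" "y \<in> pverts (graph_on n r)" "x \<noteq> y" "(x, y) \<notin> parcs (graph_on n r)"
  proof -
    have "x < n" "y \<in> set [0..<n]" using assms that by (auto simp: partner_check_def)
    moreover have "x = y \<or> joined r x y \<or> y \<in> set B"
      using assms that(1) \<open>y \<in> set [0..<n]\<close> unfolding partner_check_def by blast
    ultimately show ?thesis using that by (simp add: arc_graph_on)
  qed
qed

lemma non_doubly_eulerian_order_if_balanced:
  assumes "quartic_check n r \<and> partner_check n r A B \<and> u \<in> set B \<and> u \<notin> set A \<and> length B \<le> length A"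
  shows "non_doubly_eulerian_order n"
proof (rule non_doubly_eulerian_order_check)
  have check: "partner_check n r A B" using assms by simp
  then show "0 < n" using assms by (auto simp: partner_check_def)
  show "quartic_check n r" using assms by simp
  assume "quartic_graph (graph_on n r)"
  then interpret quartic_graph "graph_on n r" .
  show "\<not> doubly_eulerian (graph_on n r)"
    using assms partner_checkD[OF check]
    by (intro not_doubly_eulerian_if_balanced[of "set A" "set B" u]) auto
qed

text \<open>The complete graph has no nonadjacent pairs, so two distinct singletons suffice.\<close>

lemma non_doubly_eulerian_order_5: "non_doubly_eulerian_order 5"
  by (rule non_doubly_eulerian_order_if_balanced[of 5 "\<lambda>_ _. True" "[1]" "[0]" 0]) code_simp

text \<open>The octahedron, where 0 is the only vertex nonadjacent to 3.\<close>

lemma non_doubly_eulerian_order_6: "non_doubly_eulerian_order 6"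
  by (rule non_doubly_eulerian_order_if_balanced[of 6 "\<lambda>i j. i < j \<and> j \<noteq> i + 3" "[3]" "[0]" 0]) code_simp

text \<open>The complement of a triangle on 0, 5, 6 and a 4-cycle in which 1 and 2 are the
  neighbours of both 3 and 4.\<close>

lemma non_doubly_eulerian_order_7: "non_doubly_eulerian_order 7"
  by (rule non_doubly_eulerian_order_if_balanced[of 7
        "\<lambda>i j. i \<in> {1..4} \<and> j \<in> {0, 5, 6} \<or> (i, j) \<in> {(1, 2), (3, 4)}" "[3, 4]" "[1, 2]" 1]) code_simp

text \<open>Two copies of K4 joined by a perfect matching; \<open>A\<close> and \<open>B\<close> are
  the copies.\<close>

lemma non_doubly_eulerian_order_8: "non_doubly_eulerian_order 8"
  by (rule non_doubly_eulerian_order_if_balanced[of 8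
        "\<lambda>i j. i div 4 = j div 4 \<or> j = i + 4" "[4..<8]" "[0..<4]" 0]) code_simp

text \<open>Two copies of K4, on 0 to 3 and 5 to 8, joined by the edges 2-7 and 3-8 and by a vertex
  4 adjacent to 0, 1, 5 and 6.\<close>

lemma non_doubly_eulerian_order_9: "non_doubly_eulerian_order 9"
proof -
  define r :: "nat \<Rightarrow> nat \<Rightarrow> bool" where
    "r i j \<longleftrightarrow> i < 4 \<and> j < 4 \<or> 4 < i \<and> 4 < j \<or> (i, j) \<in> {(0, 4), (1, 4), (4, 5), (4, 6), (2, 7), (3, 8)}" for i j
  have check: "quartic_check 9 r" "partner_check 9 r [5..<9] [0..<5]"
    and nbrs: "\<forall>x\<in>set [0..<9]. joined r 0 x \<longrightarrow> x \<in> set [0..<5]"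
    unfolding r_def by code_simp+
  show ?thesis
  proof (rule non_doubly_eulerian_order_check[OF _ check(1)])
    assume "quartic_graph (graph_on 9 r)"
    then interpret quartic_graph "graph_on 9 r" .
    show "\<not> doubly_eulerian (graph_on 9 r)"
      using partner_checkD[OF check(2)] nbrs
      by (intro not_doubly_eulerian_if_nearly_balanced[of "set [5..<9]" "set [0..<5]" 0])
        (auto simp: arc_graph_on)
  qed simp
qed

text \<open>K5 minus the edge 3-4 and K5 minus the edge 5-6, joined by 3-5 and 4-6. The circuits
  start at 0, and 5, 6 is the only nonadjacent pair of the other copy.\<close>

lemma non_doubly_eulerian_order_10: "non_doubly_eulerian_order 10"
proof -
  define r :: "nat \<Rightarrow> nat \<Rightarrow> bool" where
    "r i j \<longleftrightarrow> i < j \<and> ((j < 5 \<or> 5 \<le> i) \<and> (i, j) \<notin> {(3, 4), (5, 6)} \<or> (i, j) \<in> {(3, 5), (4, 6)})" for i j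
  have check: "quartic_check 10 r"
    and nbrs: "\<forall>x\<in>set [0..<10]. joined r 0 x \<longrightarrow> x \<notin> set [5..<10]"
    and cut: "\<forall>x\<in>set [5..<10]. \<forall>y\<in>set [0..<10]. y \<in> set [5..<10] \<or> \<not> joined r x y \<or> (x, y) \<in> {(5, 3), (6, 4)}"
    and partner: "\<forall>x\<in>set [5..<10]. \<forall>y\<in>set [5..<10]. x = y \<or> joined r x y \<or> x \<in> {5, 6}"
    and indep: "\<forall>x\<in>{5, 6}. \<forall>y\<in>{5, 6}. \<not> joined r x y"
    unfolding r_def by code_simp+
  show ?thesis
  proof (rule non_doubly_eulerian_order_check[OF _ check])
    assume "quartic_graph (graph_on 10 r)"
    then interpret quartic_graph "graph_on 10 r" .
    show "\<not> doubly_eulerian (graph_on 10 r)"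
    proof (rule not_doubly_eulerian_if_two_edge_cut)
      let ?C = "set [5..<10::nat]" and ?F = "{edge_of (5, 3), edge_of (6, 4::nat)}" and ?D = "{5, 6::nat}"
      show "0 \<in> pverts (graph_on 10 r)" "0 \<notin> ?C" "?C \<subseteq> pverts (graph_on 10 r)"
        and "card (pverts (graph_on 10 r)) = 2 * card ?C"
        by auto
      show "finite ?F" "card ?F \<le> 2" by (auto intro: card_insert_le_m1)
      show "x \<notin> ?C" if "(0, x) \<in> parcs (graph_on 10 r)" for x
        using nbrs that by (simp add: arc_graph_on)
      show "edge_of (x, y) \<in> ?F" if "x \<in> ?C" "y \<notin> ?C" "(x, y) \<in> parcs (graph_on 10 r)" for x y
      proof -
        have y: "y \<in> set [0..<10]" and r: "joined r x y" using that(3) by (simp_all add: arc_graph_on)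
        then have "(x, y) \<in> {(5, 3), (6, 4)}" using cut that(1,2) by blast
        then show ?thesis by blast
      qed
      show "x \<in> ?D" if "x \<in> ?C" "y \<in> ?C" "x \<noteq> y" "(x, y) \<notin> parcs (graph_on 10 r)" for x y
      proof -
        have "\<not> joined r x y" using that by (auto simp: arc_graph_on)
        then show ?thesis using partner that(1-3) by blast
      qed
      show "(x, y) \<notin> parcs (graph_on 10 r)" if "x \<in> ?D" "y \<in> ?D" for x y
        using indep that by (simp only: arc_graph_on) blast
    qed
  qed simp
qed

section \<open>Graphs with a cut vertex\<close>

text \<open>
  A lobe is the square of a path on \<open>{0..<k}\<close> with two chords that leave precisely the ends
  \<open>0\<close> and \<open>k - 1\<close> with degree 3. For \<open>k = 5\<close> the ends cannot be
  adjacent: the only such graph is the complete graph minus an edge.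
\<close>

definition lobe :: "nat \<Rightarrow> nat \<Rightarrow> nat \<Rightarrow> bool" where
  "lobe k i j \<longleftrightarrow> j = i + 1 \<or> j = i + 2 \<or>
     (if k = 5 then i = 0 \<and> j = 3 \<or> i = 1 \<and> j = 4 else i = 0 \<and> j = k - 1 \<or> i = 1 \<and> j = k - 2)"

text \<open>The path square has degree 2 at its ends, 3 next to them and 4 elsewhere; the two chords
  add one to each of the four lower degrees.\<close>

lemma card_lobe_neighbours:
  assumes "5 \<le> k" "i < k"
  shows "card {j. j < k \<and> joined (lobe k) i j} = (if i = 0 \<or> i = k - 1 then 3 else 4)"
proof (cases "k = 5")
  case True
  have "\<forall>i\<in>set [0..<5]. length (filter (joined (lobe 5) i) [0..<5]) = (if i = 0 \<or> i = 4 then 3 else 4)"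
    by code_simp
  moreover have "{j. j < 5 \<and> joined (lobe 5) i j} = set (filter (joined (lobe 5) i) [0..<5])" by auto
  then have "card {j. j < 5 \<and> joined (lobe 5) i j} = length (filter (joined (lobe 5) i) [0..<5])"
    by (metis distinct_card distinct_filter distinct_upt)
  ultimately show ?thesis using True assms by simp
next
  case False
  \<comment> \<open>Writing \<open>k = m + 6\<close>, and below \<open>i = h + 2\<close>, keeps
    truncated subtraction out of the neighbour lists.\<close>
  then have "k = (k - 6) + 6" using assms(1) by simp
  then obtain m where k: "k = m + 6" by (rule that)
  let ?N = "{j. j < k \<and> joined (lobe k) i j}"
  consider "i = 0" | "i = 1" | "2 \<le> i" "i < m + 4" | "i = m + 4" | "i = m + 5"
    using assms k by linarith
  then show ?thesis
  proof cases
    case 1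
    have "j \<in> ?N \<longleftrightarrow> j \<in> {1, 2, m + 5}" for j
      unfolding 1 k joined_def lobe_def by simp presburger
    then have "?N = {1, 2, m + 5}" by blast
    then show ?thesis using 1 by simp
  next
    case 2
    have "j \<in> ?N \<longleftrightarrow> j \<in> {0, 2, 3, m + 4}" for j
      unfolding 2 k joined_def lobe_def by simp presburger
    then have "?N = {0, 2, 3, m + 4}" by blast
    then show ?thesis using 2 k by simp
  next
    case 3
    then obtain h where h: "i = h + 2" by (metis le_add_diff_inverse2)
    have "j \<in> ?N \<longleftrightarrow> j \<in> {h, h + 1, h + 3, h + 4}" for j
      using 3 unfolding h k joined_def lobe_def by simp presburger
    then have "?N = {h, h + 1, h + 3, h + 4}" by blast
    then show ?thesis using 3 k h by simp
  next
    case 4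
    have "j \<in> ?N \<longleftrightarrow> j \<in> {1, m + 2, m + 3, m + 5}" for j
      unfolding 4 k joined_def lobe_def by simp presburger
    then have "?N = {1, m + 2, m + 3, m + 5}" by blast
    then show ?thesis using 4 k by simp
  next
    case 5
    have "j \<in> ?N \<longleftrightarrow> j \<in> {0, m + 3, m + 4}" for j
      unfolding 5 k joined_def lobe_def by simp presburger
    then have "?N = {0, m + 3, m + 4}" by blast
    then show ?thesis using 5 k by simp
  qed
qed

text \<open>Vertex \<open>k\<close> is the cut vertex. One lobe lies below it, the other above it
  after a shift by \<open>Suc k\<close>, and its neighbours are the four lobe ends.\<close>

definition two_lobes :: "nat \<Rightarrow> nat \<Rightarrow> nat \<Rightarrow> nat \<Rightarrow> bool" where
  "two_lobes k l i j \<longleftrightarrow>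
     i < k \<and> j < k \<and> lobe k i j \<or> k < i \<and> k < j \<and> lobe l (i - Suc k) (j - Suc k) \<or>
     j = k \<and> i \<in> {0, k - 1, Suc k, k + l}"

lemma joined_two_lobes:
  assumes "5 \<le> k" "5 \<le> l"
  shows "joined (two_lobes k l) i j \<longleftrightarrow>
    i < k \<and> j < k \<and> joined (lobe k) i j \<or>
    k < i \<and> k < j \<and> joined (lobe l) (i - Suc k) (j - Suc k) \<or>
    j = k \<and> i \<in> {0, k - 1, Suc k, k + l} \<or> i = k \<and> j \<in> {0, k - 1, Suc k, k + l}"
proof -
  have "i - Suc k \<noteq> j - Suc k \<longleftrightarrow> i \<noteq> j" if "k < i" "k < j"
    using that by linarith
  then show ?thesis
    using assms(1,2) unfolding joined_def two_lobes_def
    by (cases i k rule: linorder_cases; cases j k rule: linorder_cases) auto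
qed

text \<open>Lobe ends have three neighbours in their lobe and gain \<open>k\<close>; all other lobe
  vertices already have four.\<close>

lemma card_two_lobes_neighbours:
  assumes "5 \<le> k" "5 \<le> l" "v \<le> k + l"
  shows "card {j. j < Suc (k + l) \<and> joined (two_lobes k l) v j} = 4"
proof -
  let ?N = "{j. j < Suc (k + l) \<and> joined (two_lobes k l) v j}"
  have N: "?N = {j. j \<le> k + l \<and> (
    v < k \<and> j < k \<and> joined (lobe k) v j \<or>
    k < v \<and> k < j \<and> joined (lobe l) (v - Suc k) (j - Suc k) \<or>
    j = k \<and> v \<in> {0, k - 1, Suc k, k + l} \<or> v = k \<and> j \<in> {0, k - 1, Suc k, k + l})}"
    using joined_two_lobes[OF assms(1,2)] by (auto simp: less_Suc_eq_le)
  consider "v < k" | "v = k" | "k < v" by linarith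
  then show ?thesis
  proof cases
    case 1
    let ?M = "{j. j < k \<and> joined (lobe k) v j}"
    have "?N = ?M \<union> (if v = 0 \<or> v = k - 1 then {k} else {})"
      unfolding N using 1 assms by auto
    moreover have "card ?M = (if v = 0 \<or> v = k - 1 then 3 else 4)"
      using card_lobe_neighbours[OF assms(1) 1] .
    ultimately show ?thesis by (auto simp: card_insert_if)
  next
    case 2
    then have "?N = {0, k - 1, Suc k, k + l}"
      unfolding N using assms by auto
    moreover have "0 \<noteq> k - 1" "k - 1 \<noteq> Suc k" "k - 1 \<noteq> k + l" "Suc k \<noteq> k + l" "k + l \<noteq> 0"
      using assms by auto
    ultimately show ?thesis by simp
  next
    case 3
    let ?M = "{j. j < l \<and> joined (lobe l) (v - Suc k) j}"
    have "{j. k < j \<and> j \<le> k + l \<and> joined (lobe l) (v - Suc k) (j - Suc k)} = (\<lambda>j. j + Suc k) ` ?M" (is "?A = ?B")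
    proof (intro subset_antisym subsetI)
      fix j assume "j \<in> ?A"
      then show "j \<in> ?B" by (intro image_eqI[of _ _ "j - Suc k"]) auto
    qed auto
    moreover have "?N = ?A \<union> (if v = Suc k \<or> v = k + l then {k} else {})"
      unfolding N using 3 assms by auto
    moreover have "card ((\<lambda>j. j + Suc k) ` ?M) = (if v - Suc k = 0 \<or> v - Suc k = l - 1 then 3 else 4)"
    proof -
      have "v - Suc k < l" using 3 assms(3) by simp
      from card_lobe_neighbours[OF assms(2) this] show ?thesis
        by (subst card_image) (simp_all add: inj_on_def)
    qed
    moreover have "v - Suc k = 0 \<or> v - Suc k = l - 1 \<longleftrightarrow> v = Suc k \<or> v = k + l"
      using 3 assms by auto
    moreover have "k \<notin> (\<lambda>j. j + Suc k) ` ?M" by auto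
    moreover have "finite ((\<lambda>j. j + Suc k) ` ?M)" by simp
    ultimately show ?thesis by (cases "v = Suc k \<or> v = k + l") simp_all
  qed
qed

lemma non_doubly_eulerian_order_two_lobes:
  assumes "5 \<le> k" and l: "l = k \<or> l = Suc k"
  shows "non_doubly_eulerian_order (Suc (k + l))"
proof (rule non_doubly_eulerian_orderI)
  let ?r = "two_lobes k l" and ?n = "Suc (k + l)"
  have l5: "5 \<le> l" using assms by auto
  show "\<exists>w<v. joined ?r w v" if "0 < v" "v < ?n" for v
  proof -
    obtain w where w: "v = Suc w" using \<open>0 < v\<close> by (cases v) auto
    have lobe: "joined (lobe m) x (Suc x)" for m x by (simp add: joined_def lobe_def)
    \<comment> \<open>The vertices form a path in increasing order, since \<open>k - 1\<close> and
      \<open>Suc k\<close> are lobe ends.\<close>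
    have "joined ?r w (Suc w)"
    proof (cases w k rule: linorder_cases)
      case less
      then show ?thesis
        using lobe joined_two_lobes[OF assms(1) l5] by (cases "Suc w = k") auto
    next
      case greater
      then have "Suc w - Suc k = Suc (w - Suc k)" by simp
      then show ?thesis
        using greater lobe[of l "w - Suc k"] joined_two_lobes[OF assms(1) l5, of w "Suc w"] by simp
    qed (use joined_two_lobes[OF assms(1) l5] in simp)
    then show ?thesis using w by blast
  qed
  show "card {j. j < ?n \<and> joined ?r v j} = 4" if "v < ?n" for v
    using card_two_lobes_neighbours[OF assms(1) l5, of v] that by simp
  assume "quartic_graph (graph_on ?n ?r)"
  then interpret quartic_graph "graph_on ?n ?r" .
  have arc: "(i, j) \<in> parcs (graph_on ?n ?r) \<longleftrightarrow> i \<le> k + l \<and> j \<le> k + l \<and>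
      (i < k \<and> j < k \<and> joined (lobe k) i j \<or>
       k < i \<and> k < j \<and> joined (lobe l) (i - Suc k) (j - Suc k) \<or>
       j = k \<and> i \<in> {0, k - 1, Suc k, k + l} \<or> i = k \<and> j \<in> {0, k - 1, Suc k, k + l})" for i j
    using joined_two_lobes[OF assms(1) l5] by (auto simp: arc_graph_on less_Suc_eq_le)
  show "\<not> doubly_eulerian (graph_on ?n ?r)"
  proof (rule not_doubly_eulerian_if_cut_vertex[of k "{..<k}" "{k<..<?n}"])
    show "card {k<..<?n} = card {..<k} \<or> card {k<..<?n} = Suc (card {..<k}) \<and>
      (\<forall>x\<in>{k<..<?n}. \<forall>y\<in>{k<..<?n}. (k, x) \<in> parcs (graph_on ?n ?r) \<and> (k, y) \<in> parcs (graph_on ?n ?r)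
         \<longrightarrow> x = y \<or> (x, y) \<in> parcs (graph_on ?n ?r))"
    proof (cases "l = k")
      case False
      \<comment> \<open>Here \<open>l \<ge> 6\<close>, so the second lobe has the chord joining its
        ends, which are the only neighbours of \<open>k\<close> in it.\<close>
      then have "l = Suc k" using l by simp
      then have "joined (lobe l) 0 (l - 1)" "joined (lobe l) (l - 1) 0"
        using assms(1) by (auto simp: joined_def lobe_def)
      then have "(Suc k, k + l) \<in> parcs (graph_on ?n ?r)" "(k + l, Suc k) \<in> parcs (graph_on ?n ?r)"
        using l5 by (simp_all add: arc)
      moreover have "x = Suc k \<or> x = k + l" if "x \<in> {k<..<?n}" "(k, x) \<in> parcs (graph_on ?n ?r)" for x
        using that by (auto simp: arc)
      ultimately have "\<forall>x\<in>{k<..<?n}. \<forall>y\<in>{k<..<?n}. (k, x) \<in> parcs (graph_on ?n ?r) \<and> (k, y) \<in> parcs (graph_on ?n ?r)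
         \<longrightarrow> x = y \<or> (x, y) \<in> parcs (graph_on ?n ?r)" by metis
      then show ?thesis using \<open>l = Suc k\<close> by simp
    qed simp
    show "(x, y) \<notin> parcs (graph_on ?n ?r)" if "x \<in> {..<k}" "y \<in> {k<..<?n}" for x y
      using that by (simp add: arc)
    show "pverts (graph_on ?n ?r) = insert k ({..<k} \<union> {k<..<?n})" by auto
    show "{..<k} \<noteq> {}" using assms(1) by (simp add: lessThan_empty_iff)
    show "{k<..<?n} \<noteq> {}" using l5 by (intro ex_in_conv[THEN iffD1] exI[of _ "Suc k"]) simp
  qed auto
qed simp

theorem theorem12:
  fixes n :: nat
  assumes "n \<ge> 5"
  shows "\<exists>G :: nat pair_pre_digraph.
           pair_graph G \<and> Digraph_Component.connected (with_proj G) \<and>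
           card (pverts G) = n \<and> regular 4 G \<and> \<not> doubly_eulerian G"
proof -
  have "non_doubly_eulerian_order n"
  proof (cases "n \<le> 10")
    case True
    then have "n \<in> {5, 6, 7, 8, 9, 10}" using assms by auto
    then show ?thesis
      using non_doubly_eulerian_order_5 non_doubly_eulerian_order_6 non_doubly_eulerian_order_7 non_doubly_eulerian_order_8 non_doubly_eulerian_order_9 non_doubly_eulerian_order_10 by auto
  next
    case False
    \<comment> \<open>The vertices other than the cut vertex are split as evenly as possible;
      \<open>n \<ge> 11\<close> gives each lobe at least 5.\<close>
    then have "n = Suc ((n - 1) div 2 + n div 2)" "5 \<le> (n - 1) div 2"
      "n div 2 = (n - 1) div 2 \<or> n div 2 = Suc ((n - 1) div 2)" by presburger+
    then show ?thesis using non_doubly_eulerian_order_two_lobes by metis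
  qed
  then show ?thesis by (simp only: non_doubly_eulerian_order_def)
qed

end
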